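(* Let $n\ge1$. For all $A\in M_n(\mathbb{C})$, $$|G_k(A)|\le \mathrm{per}(|A|)\quad\text{for all }k\in\{0,\dots,n-1\},\qquad \|D_\phi(A)\|_2\le\sqrt n\;\mathrm{per}(|A|).$$
   Context: Let $\omega=e^{2\pi i/n}$, let $S_n$ be the symmetric group on $\{1,\dots,n\}$ with composition $(\sigma\circ\tau)(i)=\sigma(\tau(i))$, let $\varepsilon(\sigma)$ be the sign of $\sigma$, and let $\rho=(1\,2\,\cdots\,n)$ be the cycle $\rho(i)=i+1$ for $i<n$, $\rho(n)=1$. Each orbit $\{\sigma\circ\rho^r: r\in\mathbb{Z}/n\mathbb{Z}\}$ contains exactly one permutation $\sigma^*$ with $\sigma^*(1)=1$. The orbital phase $\phi:S_n\to\mathbb{Z}/n\mathbb{Z}$ is the unique function such that $\phi(\sigma^*\circ\rho^r)=r$ for every $\sigma^*\in S_n$ with $\sigma^*(1)=1$ and every $r$. For $A=(a_{ij})\in M_n(\mathbb{C})$ put $m_\sigma(A)=\varepsilon(\sigma)\prod_{i=1}^n a_{i,\sigma(i)}$, $\Lambda_r(A)=\sum_{\sigma:\phi(\sigma)=r}m_\sigma(A)$ for $r=0,\dots,n-1$, $G_k(A)=\sum_{r=0}^{n-1}\Lambda_r(A)\omega^{kr}$, and $D_\phi(A)=(G_0(A),\dots,G_{n-1}(A))\in\mathbb{C}^n$ with Euclidean norm $\|\cdot\|_2$. $|A|$ denotes the matrix with entries $|a_{ij}|$, and $\mathrm{per}(B)=\sum_{\sigma\in S_n}\prod_i b_{i,\sigma(i)}$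 is the permanent. *)

theory Defs
  imports
    "HOL-Analysis.L2_Norm"
    "HOL-Analysis.Complex_Transcendental"
    "HOL-Combinatorics.Permutations"
    "HOL-Number_Theory.Cong"
    "Jordan_Normal_Form.Matrix"
begin

definition rho :: "nat \<Rightarrow> nat \<Rightarrow> nat" where
  "rho n i = (if 1 \<le> i \<and> i < n then i + 1 else if i = n then 1 else i)"

text \<open>Elements of $\mathbb{Z}/n\mathbb{Z}$ are represented by their residues in
  $\{0,\dots,n-1\}$, and $S_n$ consists of the functions that permute \<open>{1..n}\<close> and
  fix every other natural number.\<close>

definition orbital_phase :: "nat \<Rightarrow> (nat \<Rightarrow> nat) \<Rightarrow> nat" where
  "orbital_phase n \<sigma> =
    (THE r. r < n \<and> (\<exists>\<tau>. \<tau> permutes {1..n} \<and> \<tau> 1 = 1 \<and> \<sigma> = \<tau> \<circ> (rho n ^^ r)))"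

text \<open>Library matrices are indexed from 0, permutations act on \<open>{1..n}\<close>: the
  entry $a_{ij}$ is \<open>A $$ (i - 1, j - 1)\<close>.\<close>

definition perm_term :: "complex mat \<Rightarrow> (nat \<Rightarrow> nat) \<Rightarrow> complex" where
  "perm_term A \<sigma> = of_int (sign \<sigma>) * (\<Prod>i = 1..dim_row A. A $$ (i - 1, \<sigma> i - 1))"

definition Lambda_sum :: "complex mat \<Rightarrow> nat \<Rightarrow> complex" where
  "Lambda_sum A r =
    (\<Sum>\<sigma> | \<sigma> permutes {1..dim_row A} \<and> orbital_phase (dim_row A) \<sigma> = r. perm_term A \<sigma>)"

definition omega :: "nat \<Rightarrow> complex" where
  "omega n = exp (2 * of_real pi * \<i> / of_nat n)"

definition G_coeff :: "complex mat \<Rightarrow> nat \<Rightarrow> complex" where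
  "G_coeff A k = (\<Sum>r<dim_row A. Lambda_sum A r * omega (dim_row A) ^ (k * r))"

definition D_phi :: "complex mat \<Rightarrow> complex vec" where
  "D_phi A = vec (dim_row A) (G_coeff A)"

definition euclidean_norm :: "complex vec \<Rightarrow> real" where
  "euclidean_norm v = L2_set (\<lambda>k. cmod (v $ k)) {..<dim_vec v}"

definition permanent :: "'a::comm_ring_1 mat \<Rightarrow> 'a" where
  "permanent B =
    (\<Sum>\<sigma> | \<sigma> permutes {1..dim_row B}. \<Prod>i = 1..dim_row B. B $$ (i - 1, \<sigma> i - 1))"

text \<open>The orbital phase is well defined and has its characterizing property.\<close>

lemma rho_permutes:
  assumes "1 \<le> n"
  shows "rho n permutes {1..n}"
proof (rule bij_imp_permutes)
  have "inj_on (rho n) {1..n}"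
    by (auto simp: inj_on_def rho_def split: if_splits)
  moreover have "rho n ` {1..n} \<subseteq> {1..n}"
    using assms by (auto simp: rho_def)
  ultimately show "bij_betw (rho n) {1..n} {1..n}"
    by (simp add: bij_betw_def endo_inj_surj)
qed (use assms in \<open>auto simp: rho_def\<close>)

lemma rho_funpow_permutes:
  assumes "1 \<le> n"
  shows "(rho n ^^ r) permutes {1..n}"
proof (induction r)
  case (Suc r)
  then show ?case
    using permutes_compose[OF Suc rho_permutes[OF assms]] by (simp only: funpow.simps)
qed (simp add: permutes_id id_def[symmetric])

lemma rho_funpow_apply:
  assumes "i \<in> {1..n}"
  shows "(rho n ^^ r) i = (i - 1 + r) mod n + 1"
proof (induction r)
  case 0
  then show ?case using assms by auto
next
  case (Suc r)
  let ?m = "(i - 1 + r) mod n"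
  have "?m < n" using assms by auto
  have "(rho n ^^ Suc r) i = rho n (?m + 1)" using Suc by simp
  also have "\<dots> = Suc ?m mod n + 1"
  proof (cases "Suc ?m = n")
    case True
    then have "rho n (?m + 1) = 1" by (simp add: rho_def)
    then show ?thesis using True by simp
  next
    case False
    then have "Suc ?m < n" using \<open>?m < n\<close> by simp
    then show ?thesis by (simp add: rho_def)
  qed
  also have "Suc ?m mod n = (i - 1 + Suc r) mod n"
    by (simp add: mod_Suc_eq)
  finally show ?case .
qed

lemma orbital_phase_comp_rho:
  assumes "\<tau> permutes {1..n}" "\<tau> 1 = 1" "r < n"
  shows "orbital_phase n (\<tau> \<circ> (rho n ^^ r)) = r"
  unfolding orbital_phase_def
proof (rule the_equality)
  fix s
  assume "s < n \<and> (\<exists>\<tau>'. \<tau>' permutes {1..n} \<and> \<tau>' 1 = 1 \<and>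
    \<tau> \<circ> (rho n ^^ r) = \<tau>' \<circ> (rho n ^^ s))"
  then obtain \<tau>' where s: "s < n" and \<tau>': "\<tau>' 1 = 1"
    and eq: "\<tau> \<circ> (rho n ^^ r) = \<tau>' \<circ> (rho n ^^ s)"
    by blast
  have n: "1 \<le> n" using s by simp
  obtain i where i: "i \<in> {1..n}" "(rho n ^^ s) i = 1"
    using permutes_image[OF rho_funpow_permutes[OF n, of s]] n
    by (metis atLeastAtMost_iff image_iff order_refl)
  have "\<tau> ((rho n ^^ r) i) = \<tau> 1"
    using fun_cong[OF eq, of i] i \<tau>' assms by simp
  then have "(rho n ^^ r) i = 1"
    using permutes_inj[OF assms(1)] by (simp add: inj_eq)
  then have "(i - 1 + r) mod n = (i - 1 + s) mod n"
    using i by (simp add: rho_funpow_apply)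
  then have "r mod n = s mod n"
    by (metis cong_def cong_add_lcancel_nat)
  then show "s = r" using s assms by simp
qed (use assms in blast)

lemma permutes_eq_comp_rho:
  assumes "1 \<le> n" "\<sigma> permutes {1..n}"
  obtains \<tau> r where "\<tau> permutes {1..n}" "\<tau> 1 = 1" "r < n" "\<sigma> = \<tau> \<circ> (rho n ^^ r)"
proof -
  obtain i where i: "i \<in> {1..n}" "\<sigma> i = 1"
    using permutes_image[OF assms(2)] assms(1)
    by (metis atLeastAtMost_iff image_iff order_refl)
  define r where "r = (n - (i - 1)) mod n"
  have r: "r < n" using assms(1) by (simp add: r_def)
  have "(i - 1 + r) mod n = 0"
  proof -
    have "(i - 1 + r) mod n = (i - 1 + (n - (i - 1))) mod n"
      unfolding r_def by (rule mod_add_right_eq)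
    also have "i - 1 + (n - (i - 1)) = n" using i by auto
    finally show ?thesis by simp
  qed
  then have ri: "(rho n ^^ r) i = 1" using i by (simp add: rho_funpow_apply)
  have p: "(rho n ^^ r) permutes {1..n}" by (rule rho_funpow_permutes[OF assms(1)])
  let ?\<tau> = "\<sigma> \<circ> inv_into UNIV (rho n ^^ r)"
  have "?\<tau> permutes {1..n}"
    using permutes_compose[OF permutes_inv[OF p] assms(2)] .
  moreover have "?\<tau> 1 = 1"
    using permutes_inverses(2)[OF p, of i] ri i by simp
  moreover have "\<sigma> = ?\<tau> \<circ> (rho n ^^ r)"
    using permutes_inverses(2)[OF p] by (auto simp: fun_eq_iff)
  ultimately show ?thesis using that r by blast
qed

end

theory Submission
  imports Defs
begin

text \<open>
  Everything is the triangle inequality. Each signed monomial \<open>m\<^sub>\<sigma>(A)\<close> has modulus equal to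
  the corresponding monomial of \<open>|A|\<close>, because a sign has modulus one. The level sets of the
  orbital phase partition the symmetric group, so the moduli of all the monomials that occur in
  the sums \<open>\<Lambda>\<^sub>r(A)\<close>, taken over all \<open>r\<close>, add up to \<open>per(|A|)\<close>. Passing from the
  \<open>\<Lambda>\<^sub>r\<close> to \<open>G\<^sub>k\<close> only multiplies them by roots of unity, which
  do not change moduli; hence \<open>|G\<^sub>k(A)| \<le> per(|A|)\<close>. A vector with \<open>n\<close> coordinates, each of
  modulus at most \<open>P\<close>, has Euclidean norm at most \<open>\<surd>n \<cdot> P\<close>, which gives the second bound.
\<close>

lemma orbital_phase_less:
  assumes "1 \<le> n" "\<sigma> permutes {1..n}"
  shows "orbital_phase n \<sigma> < n"
  using permutes_eq_comp_rho[OF assms] orbital_phase_comp_rho by metis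

lemma cmod_omega_power: "cmod (omega n ^ m) = 1"
proof -
  have "omega n = cis (2 * pi / real n)"
    by (simp add: omega_def cis_conv_exp mult.commute)
  then show ?thesis
    by (simp add: norm_power)
qed

lemma cmod_perm_term:
  assumes "A \<in> carrier_mat n n" "\<sigma> permutes {1..n}"
  shows "cmod (perm_term A \<sigma>) = (\<Prod>i = 1..n. map_mat cmod A $$ (i - 1, \<sigma> i - 1))"
proof -
  have "cmod (of_int (sign \<sigma>)) = 1"
    by (simp add: sign_def)
  moreover have "cmod (A $$ (i - 1, \<sigma> i - 1)) = map_mat cmod A $$ (i - 1, \<sigma> i - 1)"
    if "i \<in> {1..n}" for i
  proof -
    have "\<sigma> i \<in> {1..n}"
      using permutes_in_image[OF assms(2)] that by blast
    then have "i - 1 < n" "\<sigma> i - 1 < n"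
      using that by auto
    then show ?thesis
      using assms(1) by simp
  qed
  ultimately show ?thesis
    using assms(1) by (simp add: perm_term_def norm_mult prod_norm[symmetric])
qed

text \<open>The only point where the combinatorics of the orbital phase enters: its level sets
  are disjoint and exhaust the symmetric group, so that the double sum over phases and over
  permutations of a given phase runs through every permutation exactly once.\<close>

lemma sum_cmod_Lambda_sum_le_permanent:
  assumes "1 \<le> n" "A \<in> carrier_mat n n"
  shows "(\<Sum>r<n. cmod (Lambda_sum A r)) \<le> permanent (map_mat cmod A)"
proof -
  let ?S = "{\<sigma>. \<sigma> permutes {1..n}}"
  have dim: "dim_row A = n"
    using assms(2) by simp
  have "(\<Sum>r<n. cmod (Lambda_sum A r))
      \<le> (\<Sum>r<n. \<Sum>\<sigma> | \<sigma> \<in> ?S \<and> orbital_phase n \<sigma> = r. cmod (perm_term A \<sigma>))"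
    by (intro sum_mono) (simp add: Lambda_sum_def dim norm_sum)
  also have "\<dots> = (\<Sum>\<sigma>\<in>?S. cmod (perm_term A \<sigma>))"
    using orbital_phase_less[OF assms(1)]
    by (intro sum.group) (auto simp: finite_permutations)
  also have "\<dots> = permanent (map_mat cmod A)"
    unfolding permanent_def using cmod_perm_term[OF assms(2)] dim
    by (intro sum.cong) auto
  finally show ?thesis .
qed

lemma cmod_G_coeff_le_permanent:
  assumes "1 \<le> n" "A \<in> carrier_mat n n"
  shows "cmod (G_coeff A k) \<le> permanent (map_mat cmod A)"
proof -
  have "cmod (G_coeff A k) \<le> (\<Sum>r<n. cmod (Lambda_sum A r * omega n ^ (k * r)))"
    using assms(2) unfolding G_coeff_def by (simp add: norm_sum)
  also have "\<dots> = (\<Sum>r<n. cmod (Lambda_sum A r))"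
    by (simp only: norm_mult cmod_omega_power mult_1_right)
  also have "\<dots> \<le> permanent (map_mat cmod A)"
    by (rule sum_cmod_Lambda_sum_le_permanent[OF assms])
  finally show ?thesis .
qed

lemma euclidean_norm_le_sqrt_dim_times_bound:
  assumes "0 \<le> P" and bound: "\<And>k. k < dim_vec v \<Longrightarrow> cmod (v $ k) \<le> P"
  shows "euclidean_norm v \<le> sqrt (real (dim_vec v)) * P"
proof -
  have "euclidean_norm v \<le> L2_set (\<lambda>_. P) {..<dim_vec v}"
    unfolding euclidean_norm_def by (intro L2_set_mono) (auto simp: bound)
  also have "\<dots> = sqrt (real (dim_vec v)) * P"
    using assms(1) by (simp add: L2_set_def real_sqrt_mult)
  finally show ?thesis .
qed

theorem proposition3p9:
  fixes n :: nat and A :: "complex mat"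
  assumes "1 \<le> n" and "A \<in> carrier_mat n n"
  shows "(\<forall>k \<in> {0..n - 1}. cmod (G_coeff A k) \<le> permanent (map_mat cmod A))
    \<and> euclidean_norm (D_phi A) \<le> sqrt (real n) * permanent (map_mat cmod A)"
proof -
  let ?P = "permanent (map_mat cmod A)"
  have G: "cmod (G_coeff A k) \<le> ?P" for k
    by (rule cmod_G_coeff_le_permanent[OF assms])
  have "0 \<le> ?P"
    using G[of 0] norm_ge_zero order_trans by blast
  moreover have dim: "dim_vec (D_phi A) = n"
    using assms(2) by (simp add: D_phi_def)
  moreover have "cmod (D_phi A $ k) \<le> ?P" if "k < n" for k
    using that G[of k] assms(2) by (simp add: D_phi_def)
  ultimately have "euclidean_norm (D_phi A) \<le> sqrt (real n) * ?P"
    using euclidean_norm_le_sqrt_dim_times_bound[of ?P "D_phi A"] by simp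
  with G show ?thesis
    by blast
qed

end
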